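(* For any games $G, H, \widehat{H} \in \widetilde{\mathbb{G}}$, we have $$o(G :_{\widehat{H}} H) = \begin{cases} \mathcal{P} & \text{if } o(H) = \mathcal{P} \text{ and } \bigl(o(G) = \mathcal{P} \text{ or } o(\widehat{H}) = \mathcal{N}\bigr),\\ \mathcal{N} & \text{otherwise}.\end{cases}$$
   Context: Impartial games: set $\widetilde{\mathbb{G}}_0 = \{\emptyset\}$ and $\widetilde{\mathbb{G}}_n = 2^{\widetilde{\mathbb{G}}_{n-1}}$ (power set) for $n \geq 1$, and $\widetilde{\mathbb{G}} = \bigcup_{n \in \mathbb{Z}_{\geq 0}} \widetilde{\mathbb{G}}_n$. Elements of $\widetilde{\mathbb{G}}$ are called games; the elements of a game $G$ are its options. Ordinal sum with substitution: for $G, H, \widehat{H} \in \widetilde{\mathbb{G}}$, the game $G :_{\widehat{H}} H$ is defined recursively by $$G :_{\widehat{H}} H = \{ G' :_{\widehat{H}} \widehat{H} \mid G' \in G\} \cup \{ G :_{\widehat{H}} H' \mid H' \in H \}.$$ Outcome (normal play): the map $o : \widetilde{\mathbb{G}} \to \{\mathcal{P}, \mathcal{N}\}$ is defined recursively by $o(G) = \mathcal{N}$ if $o(G') = \mathcal{P}$ for some $G' \in G$, and $o(G) = \mathcal{P}$ if $o(G') = \mathcal{N}$ for all $G' \in G$. *)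

theory Defs
  imports Main "HOL-Library.FSet"
begin

text \<open>
  An impartial game is the set of its options. The games of the paper are the hereditarily
  finite sets; since \<^typ>\<open>'a fset\<close> is extensional, so is this datatype. That it is exactly the
  union of the iterated power sets of the singleton of the empty game is
  \<open>Union_games_upto\<close> below.
\<close>

datatype game = Game (options: "game fset")

fun games_upto :: "nat \<Rightarrow> game set" where
  "games_upto 0 = {Game {||}}"
| "games_upto (Suc n) = {G. fset (options G) \<subseteq> games_upto n}"

lemma games_upto_Suc: "games_upto n \<subseteq> games_upto (Suc n)"
  by (induction n) auto

lemma games_upto_mono: "m \<le> n \<Longrightarrow> games_upto m \<subseteq> games_upto n"
  by (rule lift_Suc_mono_le[of games_upto]) (rule games_upto_Suc)

lemma Union_games_upto: "(\<Union>n. games_upto n) = UNIV"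
proof -
  have "\<exists>n. G \<in> games_upto n" for G
  proof (induction G)
    case (Game A)
    then obtain f where f: "\<And>x. x \<in> fset A \<Longrightarrow> x \<in> games_upto (f x)"
      by metis
    have "x \<in> games_upto (Max (f ` fset A))" if "x \<in> fset A" for x
      using f[OF that] games_upto_mono[of "f x" "Max (f ` fset A)"] that by auto
    then have "Game A \<in> games_upto (Suc (Max (f ` fset A)))"
      by auto
    then show ?case ..
  qed
  then show ?thesis by auto
qed

lemma size_option_less [termination_simp]:
  assumes "G' |\<in>| options G"
  shows "size G' < size G"
proof (cases G)
  case (Game A)
  then have "size G' \<le> (\<Sum>x\<in>fset A. size x)"
    using assms by (auto intro: member_le_sum)
  also have "\<dots> \<le> (\<Sum>x\<in>fset A. Suc (size x))"
    by (rule sum_mono) simp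
  finally show ?thesis
    using Game by (simp add: size_fset_overloaded_simps)
qed

text \<open>
  \<open>ordinal_sum_subst K G H\<close> is the ordinal sum of \<open>G\<close> and \<open>H\<close> with substitution \<open>K\<close>: a move
  in \<open>G\<close> resets the second summand to \<open>K\<close>.
\<close>

function ordinal_sum_subst :: "game \<Rightarrow> game \<Rightarrow> game \<Rightarrow> game" where
  "ordinal_sum_subst K G H =
     Game ((\<lambda>G'. ordinal_sum_subst K G' K) |`| options G |\<union>|
           (\<lambda>H'. ordinal_sum_subst K G H') |`| options H)"
  by pat_completeness auto
termination
  by (relation "measures [\<lambda>(K, G, H). size G, \<lambda>(K, G, H). size H]")
     (auto simp: size_option_less)

declare ordinal_sum_subst.simps [simp del]

abbreviation ordinal_sum_subst_syntax :: "game \<Rightarrow> game \<Rightarrow> game \<Rightarrow> game"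
    ("(_ :\<^bsub>_\<^esub>/ _)" [66, 0, 66] 65) where
  "G :\<^bsub>K\<^esub> H \<equiv> ordinal_sum_subst K G H"

datatype outcome_class = \<P> | \<N>

function outcome :: "game \<Rightarrow> outcome_class" where
  "outcome G = (if \<exists>G' |\<in>| options G. outcome G' = \<P> then \<N> else \<P>)"
  by pat_completeness auto
termination
  by (relation "measure size") (auto simp: size_option_less)

declare outcome.simps [simp del]

lemma outcome_eq_N_iff: "outcome G = \<N> \<longleftrightarrow> (\<exists>G' |\<in>| options G. outcome G' = \<P>)"
  by (subst outcome.simps) simp

lemma outcome_eq_P_iff: "outcome G = \<P> \<longleftrightarrow> (\<forall>G' |\<in>| options G. outcome G' = \<N>)"
  by (subst outcome.simps) (metis outcome_class.distinct(1) outcome_class.exhaust)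

end

theory Submission imports Defs
begin

text \<open>
  By induction, a move \<open>G :\<^bsub>K\<^esub> H \<rightarrow> G' :\<^bsub>K\<^esub> K\<close> reaches a \<open>\<P>\<close>-position iff \<open>K\<close> and \<open>G'\<close> are both
  \<open>\<P>\<close>-positions. So the first component offers a winning move iff \<open>outcome K = \<P>\<close> and
  \<open>outcome G = \<N>\<close>; otherwise its moves are all losing and the sum is played as \<open>H\<close> alone.
\<close>

lemma outcome_neq_P_iff: "outcome G \<noteq> \<P> \<longleftrightarrow> outcome G = \<N>"
  by (cases "outcome G") simp_all

lemma outcome_ordinal_sum_subst_eq_N_iff:
  "outcome (G :\<^bsub>K\<^esub> H) = \<N> \<longleftrightarrow>
    (\<exists>G' |\<in>| options G. outcome (G' :\<^bsub>K\<^esub> K) = \<P>) \<or> (\<exists>H' |\<in>| options H. outcome (G :\<^bsub>K\<^esub> H') = \<P>)"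
  by (subst outcome_eq_N_iff, subst ordinal_sum_subst.simps) auto

theorem corollary3p8:
  fixes G H K :: game
  shows "outcome (G :\<^bsub>K\<^esub> H) =
    (if outcome H = \<P> \<and> (outcome G = \<P> \<or> outcome K = \<N>) then \<P> else \<N>)"
\<comment> \<open>A move in \<open>G\<close> replaces \<open>H\<close> by \<open>K\<close>, which
  may be larger, so the induction follows the recursion of the sum.\<close>
proof (induction K G H rule: ordinal_sum_subst.induct)
  case (1 K G H)
  \<comment> \<open>With \<open>K\<close> as second summand, the alternative
    \<open>outcome K = \<N>\<close> contradicts the required
    \<open>outcome K = \<P>\<close>.\<close>
  have G_moves: "(\<exists>G' |\<in>| options G. outcome (G' :\<^bsub>K\<^esub> K) = \<P>) \<longleftrightarrow> outcome K = \<P> \<and> outcome G = \<N>"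
    using "1.IH"(1) by (auto simp: outcome_eq_N_iff[of G] split: if_splits)
  have H_moves: "(\<exists>H' |\<in>| options H. outcome (G :\<^bsub>K\<^esub> H') = \<P>) \<longleftrightarrow>
      outcome H = \<N> \<and> (outcome G = \<P> \<or> outcome K = \<N>)"
    using "1.IH"(2) by (auto simp: outcome_eq_N_iff[of H] split: if_splits)
  \<comment> \<open>The condition in \<open>G_moves\<close> is the exact negation of the second
    conjunct in \<open>H_moves\<close>.\<close>
  have "outcome (G :\<^bsub>K\<^esub> H) = \<N> \<longleftrightarrow> \<not> (outcome H = \<P> \<and> (outcome G = \<P> \<or> outcome K = \<N>))"
    unfolding outcome_ordinal_sum_subst_eq_N_iff G_moves H_moves
    using outcome_neq_P_iff by (metis outcome_class.distinct(1))
  then show ?case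
    using outcome_neq_P_iff by auto
qed

end
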